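(* Consider $\min_{x\in X} f(x)$ with $f$ convex and $(k,L)$-piecewise smooth with pieces $\{X_i\}_{i=1}^k$. Let $\{x^t\}_{t\ge 0}$ be generated by the bundle-level method BL$(m,f^*,x^0)$ with number of cuts $m\ge k$, the optimal value $f^*$ and an initial point $x^0\in X$. Let $\{(x^{l_i},x^{r_i})\}$ be any $k$-matching pair sequence associated with this trajectory, and let $\bar\kappa(N)$ (average inter-arrival time) and $\bar\sigma(N)$ (average length) be the corresponding statistics for a given iteration count $N$. Then: (a) If $f$ is convex, then for $N\ge 1$, $$\min_{t\in\{1,\dots,N\}} f(x^t)-f^*\le \frac{L\,\bar\sigma(N)\,\bar\kappa(N)}{2N}\,\operatorname{dist}^2(x^0,X^* ).$$ (b) If moreover $f$ satisfies the quadratic growth condition with modulus $\mu>0$, then for $N\ge 1$ the sequence converges linearly to $X^*$: $$\operatorname{dist}^2(x^N,X^* )\le \Big(1+\frac1{\kappa(N)}\Big)^{-N} C\cdot\operatorname{dist}^2(x^0,X^* ),$$ $$\min_{t\in\{1,\dots,N\}} f(x^t)-f^*\le \Big(1+\frac1{\kappa(N)}\Big)^{-N} C\cdot[f(x^0)-f^*],$$ where $C>0$ is an absolute constant and the effective condition number $\kappa(N)$ is given by $\kappa(N)=O(1)\big(\bar\sigma(N)\bar\kappa(N)L/\mu\big)$.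
   Context: Setting. $X\subseteq\mathbb{R}^n$ is closed and convex, $f:X\to\mathbb{R}$ is Lipschitz continuous and bounded below, $f^*=\min_{x\in X}f(x)$, and the set of minimizers $X^*$ is non-empty. $\|\cdot\|$ is the Euclidean norm and $\operatorname{dist}(x,X^* )=\inf_{y\in X^*}\|x-y\|$. $(k,L)$-piecewise smooth: there is a covering $X\subseteq\cup_{i=1}^k X_i$ by $k$ sets (pieces) and a first-order oracle $f'$ (the gradient where $f$ is differentiable, or a specific subgradient otherwise) such that, for some $L>0$ and every $i$, $f(x)-f(\bar x)-\langle f'(\bar x),x-\bar x\rangle\le \frac L2\|x-\bar x\|^2$ for all $x,\bar x\in X_i$. The algorithm uses this oracle and does not know the pieces. Quadratic growth with modulus $\mu>0$: $f(x)-f^*\ge\frac\mu2\operatorname{dist}^2(x,X^* )$ for all $x\in X$. Algorithm BL$(m,f^*,x^0)$, $m\ge1$: for $t=0,1,2,\dots$, let $X(t)=\{x\in X: f(x^{t-i})+\langle f'(x^{t-i}),x-x^{t-i}\rangle\le f^*,\ i=0,\dots,m-1\}$ (cuts at the $m$ most recent iterates, as far as they exist) and set $x^{t+1}=\arg\min_{x\in X(t)}\frac12\|x-x^t\|^2$. $l$-matching pair (integer $l\ge1$): a pair $(x^t,x^{t+j})$ with $j\in\{1,\dots,l\}$ such that $x^t$ and $x^{t+j}$ belong to a common piece $X_{\bar\imath}$. An $l$-matching pair sequence is a set of index pairs $\{(l_i,r_i)\}_{i\ge1}$ such that each $(x^{l_i},x^{r_i})$ is an $l$-matching pair and $r_i\le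 l_{i+1}<r_{i+1}$ for all $i\ge 1$. Given such a sequence and an iteration limit $N\ge l$, $P(N)=\max\{i: r_i\le N\}$ is the number of pairs completed by iteration $N$, and the statistics are $\bar\kappa(N)=N/P(N)$ and $\bar\sigma(N)=P(N)\big/\sum_{i=1}^{P(N)}\frac1{r_i-l_i}$.
   Formalization: In (b), κ(N) uses max(L,μ) in place of L (the bound fails for L<μ), and the function-value bound is proved with t=0 included in the minimum, or over {1,…,N} with C replaced by C·max(1,κ(N)/N), since the printed bound fails for N<κ(N); C=3, O(1)=4. *)

theory Defs
  imports "HOL-Analysis.Analysis"
begin

definition opt_val :: "'a set \<Rightarrow> ('a \<Rightarrow> real) \<Rightarrow> real" where
  "opt_val X f = (INF x\<in>X. f x)"

definition minimizers :: "'a set \<Rightarrow> ('a \<Rightarrow> real) \<Rightarrow> 'a set" where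
  "minimizers X f = {x \<in> X. \<forall>y\<in>X. f x \<le> f y}"

text \<open>Only the values of \<open>f\<close> on \<open>X\<close> matter, so differentiability is asked for at interior points;
  at all remaining points of \<open>X\<close> the oracle returns some subgradient of \<open>f\<close> over \<open>X\<close>.\<close>

definition first_order_oracle ::
    "'a::euclidean_space set \<Rightarrow> ('a \<Rightarrow> real) \<Rightarrow> ('a \<Rightarrow> 'a) \<Rightarrow> bool" where
  "first_order_oracle X f f' \<longleftrightarrow>
     (\<forall>x\<in>X. if x \<in> interior X \<and> f differentiable (at x)
             then GDERIV f x :> f' x
             else (\<forall>y\<in>X. f y \<ge> f x + f' x \<bullet> (y - x)))"

text \<open>The pieces \<open>Xp 1, \<dots>, Xp k\<close> need not be contained in \<open>X\<close>, hence the intersection.\<close>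

definition piecewise_smooth ::
    "nat \<Rightarrow> real \<Rightarrow> 'a::euclidean_space set \<Rightarrow> ('a \<Rightarrow> real) \<Rightarrow> ('a \<Rightarrow> 'a) \<Rightarrow> (nat \<Rightarrow> 'a set) \<Rightarrow> bool" where
  "piecewise_smooth k L X f f' Xp \<longleftrightarrow>
     L > 0 \<and> X \<subseteq> (\<Union>i\<in>{1..k}. Xp i) \<and> first_order_oracle X f f' \<and>
     (\<forall>i\<in>{1..k}. \<forall>x\<in>Xp i \<inter> X. \<forall>y\<in>Xp i \<inter> X.
        f x - f y - f' y \<bullet> (x - y) \<le> L / 2 * (norm (x - y))\<^sup>2)"

definition quadratic_growth ::
    "'a::euclidean_space set \<Rightarrow> ('a \<Rightarrow> real) \<Rightarrow> real \<Rightarrow> bool" where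
  "quadratic_growth X f \<mu> \<longleftrightarrow>
     (\<forall>x\<in>X. f x - opt_val X f \<ge> \<mu> / 2 * (infdist x (minimizers X f))\<^sup>2)"

definition level_set ::
    "nat \<Rightarrow> real \<Rightarrow> 'a::euclidean_space set \<Rightarrow> ('a \<Rightarrow> real) \<Rightarrow> ('a \<Rightarrow> 'a) \<Rightarrow> (nat \<Rightarrow> 'a) \<Rightarrow> nat \<Rightarrow> 'a set" where
  "level_set m fs X f f' x t =
     {z \<in> X. \<forall>i<m. i \<le> t \<longrightarrow> f (x (t - i)) + f' (x (t - i)) \<bullet> (z - x (t - i)) \<le> fs}"

definition bundle_level ::
    "nat \<Rightarrow> real \<Rightarrow> 'a::euclidean_space \<Rightarrow> 'a set \<Rightarrow> ('a \<Rightarrow> real) \<Rightarrow> ('a \<Rightarrow> 'a) \<Rightarrow> (nat \<Rightarrow> 'a) \<Rightarrow> bool" where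
  "bundle_level m fs x0 X f f' x \<longleftrightarrow>
     x 0 = x0 \<and>
     (\<forall>t. is_arg_min (\<lambda>z. 1 / 2 * (norm (z - x t))\<^sup>2)
            (\<lambda>z. z \<in> level_set m fs X f f' x t) (x (Suc t)))"

definition matching_pair ::
    "nat \<Rightarrow> nat \<Rightarrow> (nat \<Rightarrow> 'a set) \<Rightarrow> (nat \<Rightarrow> 'a) \<Rightarrow> nat \<Rightarrow> nat \<Rightarrow> bool" where
  "matching_pair l k Xp x s t \<longleftrightarrow>
     (\<exists>j\<in>{1..l}. t = s + j) \<and> (\<exists>i\<in>{1..k}. x s \<in> Xp i \<and> x t \<in> Xp i)"

text \<open>Pairs are numbered from 1; the values of the index functions at 0 are irrelevant.\<close>

definition matching_pair_seq ::
    "nat \<Rightarrow> nat \<Rightarrow> (nat \<Rightarrow> 'a set) \<Rightarrow> (nat \<Rightarrow> 'a) \<Rightarrow> (nat \<Rightarrow> nat) \<Rightarrow> (nat \<Rightarrow> nat) \<Rightarrow> bool" where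
  "matching_pair_seq l k Xp x lft rgt \<longleftrightarrow>
     (\<forall>i\<ge>1. matching_pair l k Xp x (lft i) (rgt i) \<and>
            rgt i \<le> lft (i + 1) \<and> lft (i + 1) < rgt (i + 1))"

text \<open>The three statistics below are meaningful only if at least one pair is completed by
  iteration \<open>N\<close>, that is, if \<open>rgt 1 \<le> N\<close>.\<close>

definition num_pairs :: "(nat \<Rightarrow> nat) \<Rightarrow> nat \<Rightarrow> nat" where
  "num_pairs rgt N = Max {i. 1 \<le> i \<and> rgt i \<le> N}"

definition avg_interarrival :: "(nat \<Rightarrow> nat) \<Rightarrow> nat \<Rightarrow> real" where
  "avg_interarrival rgt N = real N / real (num_pairs rgt N)"

definition avg_length :: "(nat \<Rightarrow> nat) \<Rightarrow> (nat \<Rightarrow> nat) \<Rightarrow> nat \<Rightarrow> real" where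
  "avg_length lft rgt N =
     real (num_pairs rgt N) / (\<Sum>i = 1..num_pairs rgt N. 1 / (real (rgt i) - real (lft i)))"

text \<open>The \<open>O(1)\<close> factor is the explicit constant 4: an existentially quantified constant could
  depend on the dimension, which is a type parameter. The condition number \<open>L / \<mu>\<close> is taken to
  be at least 1, i.e. \<open>L\<close> is replaced by \<open>max L \<mu>\<close> (the smoothness inequality is monotone
  in \<open>L\<close>). The case \<open>L < \<mu>\<close> can occur, as for piecewise linear functions, and there linear
  convergence with \<open>L / \<mu>\<close> and absolute constants fails.\<close>

definition effective_cond ::
    "real \<Rightarrow> real \<Rightarrow> (nat \<Rightarrow> nat) \<Rightarrow> (nat \<Rightarrow> nat) \<Rightarrow> nat \<Rightarrow> real" where
  "effective_cond L \<mu> lft rgt N =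
     4 * (avg_length lft rgt N * avg_interarrival rgt N * max L \<mu> / \<mu>)"

end

theory Submission
  imports Defs
begin

text \<open>
  Write \<open>D t\<close> for the squared distance of the iterate \<open>x t\<close> to the minimizers, \<open>G t\<close> for the
  optimality gap \<open>f (x t) - f\<^sup>*\<close>, and \<open>w i\<close> for the reciprocal of the length of the pair \<open>i\<close>.

  Every cut is satisfied by all minimizers, because \<open>f'\<close> selects subgradients. Each iterate
  is thus a projection onto a convex set that contains the minimizers, so \<open>D\<close> decreases and the
  squared step lengths are paid for by the decrease of the distance to each minimizer. If
  \<open>(l, r)\<close> is a matching pair, the cut at \<open>x l\<close> is still active when \<open>x r\<close> is computed (this is
  where at least \<open>k\<close> cuts are needed), so the linearization of \<open>f\<close> at \<open>x l\<close> is at most \<open>f\<^sup>*\<close>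
  at \<open>x r\<close>, and smoothness on the common piece leaves \<open>G r \<le> L / 2 * (norm (x r - x l))\<^sup>2\<close>.
  By Cauchy-Schwarz the displacement over \<open>r - l\<close> steps is controlled by the distance decrease,
  which gives, besides the decrease of \<open>D\<close>, all that the rates need of the algorithm:
  \<open>G r \<le> L / 2 * (r - l) * (D l - D r)\<close> (lemma \<open>bundle_level_matched_descent\<close>).

  The rest concerns real sequences only, and the statistics enter through the single number
  \<open>S = (\<Sum>i. w i)\<close>, since \<open>avg_length * avg_interarrival = N / S\<close>.
  Dividing by \<open>r - l\<close> and telescoping over the pairs gives the sublinear rate
  (lemma \<open>gap_times_weight\<close>). Under quadratic growth a pair shrinks \<open>D\<close> by at least the factor
  \<open>1 + q * w i \<ge> exp (q * w i / 2)\<close>, where \<open>q = \<mu> / max L \<mu> \<le> 1\<close>; hence \<open>D\<close> is damped by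
  \<open>exp (- s / 2)\<close> with \<open>s = q * S\<close> (lemmas \<open>distance_contraction\<close> and
  \<open>final_distance_contraction\<close>). For function values the two
  bounds are combined: the sublinear rate is applied to a final group of pairs whose \<open>q * w i\<close>
  add up to between 1 and 2, and contraction to the pairs before it (lemma \<open>gap_contraction\<close>); this costs a
  factor \<open>exp 1 \<le> 3\<close>. It needs \<open>s \<ge> 1\<close>; for smaller \<open>s\<close> the linear rate is no better than
  \<open>G 0\<close> or the sublinear rate. Finally \<open>\<kappa> = 4 * N / s\<close>, so that \<open>(1 + 1 / \<kappa>) ^ N \<le> exp (s / 4)\<close>.
\<close>

section \<open>Rates from the descent inequality along matching pairs\<close>

lemma tail_sum_between_1_and_2:
  fixes u :: "nat \<Rightarrow> real"
  assumes le1: "\<And>i. i \<ge> 1 \<Longrightarrow> u i \<le> 1" and total: "1 \<le> (\<Sum>i=1..p. u i)"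
  shows "\<exists>h<p. 1 \<le> (\<Sum>i=Suc h..p. u i) \<and> (\<Sum>i=Suc h..p. u i) \<le> 2"
proof -
  let ?T = "\<lambda>h. \<Sum>i=Suc h..p. u i"
  \<comment> \<open>At the last \<open>h\<close> whose tail reaches 1, a single term was added to a tail below 1.\<close>
  define A where "A = {h. h \<le> p \<and> 1 \<le> ?T h}"
  have A: "finite A" "A \<noteq> {}"
    using total by (auto simp: A_def intro!: exI[of _ 0])
  define h where "h = Max A"
  have hA: "h \<in> A" unfolding h_def using A by (rule Max_in)
  have "h \<noteq> p" using hA by (auto simp: A_def)
  hence hp: "h < p" using hA by (simp add: A_def)
  have "Suc h \<notin> A"
    using Max_ge[OF A(1), of "Suc h"] by (auto simp: h_def)
  hence "?T (Suc h) < 1" using hp by (simp add: A_def not_le)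
  moreover have "?T h = u (Suc h) + ?T (Suc h)"
    using hp by (intro sum.atLeast_Suc_atMost) simp
  moreover have "u (Suc h) \<le> 1" by (rule le1) simp
  ultimately have "?T h \<le> 2" by simp
  thus ?thesis using hp hA by (auto simp: A_def)
qed

lemma exp_half_le_one_plus:
  fixes u :: real
  assumes "0 \<le> u" "u \<le> 1"
  shows "exp (u / 2) \<le> 1 + u"
proof -
  have "exp (u / 2) \<le> 1 + u / 2 + (u / 2)\<^sup>2" by (rule exp_bound) (use assms in auto)
  also have "(u / 2)\<^sup>2 \<le> u / 2"
    using assms unfolding power2_eq_square by (intro mult_left_le) auto
  finally show ?thesis by simp
qed

locale matched_descent =
  fixes D G :: "nat \<Rightarrow> real" and lft rgt :: "nat \<Rightarrow> nat" and L :: real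
  assumes D_decseq: "decseq D"
    and D_nonneg: "0 \<le> D t"
    and L_pos: "0 < L"
    and pair_less: "i \<ge> 1 \<Longrightarrow> lft i < rgt i"
    and pairs_ordered: "i \<ge> 1 \<Longrightarrow> rgt i \<le> lft (Suc i)"
    and pair_descent: "i \<ge> 1 \<Longrightarrow>
      G (rgt i) \<le> L / 2 * (real (rgt i) - real (lft i)) * (D (lft i) - D (rgt i))"
begin

definition w :: "nat \<Rightarrow> real" where
  "w i = 1 / (real (rgt i) - real (lft i))"

lemma w_bounds:
  assumes "i \<ge> 1"
  shows "0 < w i" "w i \<le> 1"
  using pair_less[OF assms] by (auto simp: w_def)

lemma weighted_pair_descent:
  assumes "i \<ge> 1"
  shows "G (rgt i) * w i \<le> L / 2 * (D (lft i) - D (rgt i))"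
  using pair_descent[OF assms] pair_less[OF assms] by (simp add: w_def field_simps)

lemma distance_decrease_telescopes:
  assumes "h < p"
  shows "(\<Sum>i=Suc h..p. D (lft i) - D (rgt i)) \<le> D (lft (Suc h)) - D (rgt p)"
  using assms
proof (induction p)
  case (Suc p)
  show ?case
  proof (cases "h = p")
    case False
    with Suc have "(\<Sum>i=Suc h..p. D (lft i) - D (rgt i)) \<le> D (lft (Suc h)) - D (rgt p)"
      by simp
    moreover have "D (lft (Suc p)) \<le> D (rgt p)"
      using pairs_ordered[of p] Suc.prems False by (intro decseqD[OF D_decseq]) auto
    ultimately show ?thesis using Suc.prems by simp
  qed simp
qed simp

text \<open>The sublinear rate, started at an arbitrary pair: averaging the descent inequality with
  the weights \<open>w i\<close> makes the right-hand sides telescope.\<close>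

lemma gap_times_weight:
  assumes "h < p" and low: "\<And>i. i \<in> {Suc h..p} \<Longrightarrow> g \<le> G (rgt i)"
  shows "g * (\<Sum>i=Suc h..p. w i) \<le> L / 2 * D (lft (Suc h))"
proof -
  have "g * (\<Sum>i=Suc h..p. w i) \<le> (\<Sum>i=Suc h..p. L / 2 * (D (lft i) - D (rgt i)))"
    unfolding sum_distrib_left
  proof (rule sum_mono)
    fix i assume i: "i \<in> {Suc h..p}"
    have "g * w i \<le> G (rgt i) * w i"
      using low[OF i] w_bounds(1)[of i] i by (intro mult_right_mono) auto
    also have "\<dots> \<le> L / 2 * (D (lft i) - D (rgt i))"
      using i by (intro weighted_pair_descent) auto
    finally show "g * w i \<le> L / 2 * (D (lft i) - D (rgt i))" .
  qed
  also have "\<dots> = L / 2 * (\<Sum>i=Suc h..p. D (lft i) - D (rgt i))"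
    by (simp add: sum_distrib_left)
  also have "\<dots> \<le> L / 2 * D (lft (Suc h))"
    using distance_decrease_telescopes[OF assms(1)] D_nonneg[of "rgt p"] L_pos
    by (intro mult_left_mono) auto
  finally show ?thesis .
qed

lemma sublinear_gap:
  assumes "1 \<le> p" "\<And>i. i \<in> {1..p} \<Longrightarrow> g \<le> G (rgt i)"
  shows "g * (\<Sum>i=1..p. w i) \<le> L / 2 * D 0"
proof -
  have "g * (\<Sum>i=1..p. w i) \<le> L / 2 * D (lft 1)"
    using gap_times_weight[of 0 p g] assms by simp
  also have "\<dots> \<le> L / 2 * D 0"
    using L_pos decseqD[OF D_decseq, of 0 "lft 1"] by (intro mult_left_mono) auto
  finally show ?thesis .
qed

lemma total_weight_pos: "1 \<le> p \<Longrightarrow> 0 < (\<Sum>i=1..p. w i)"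
  using w_bounds(1) by (intro sum_pos) auto

end

text \<open>The rate \<open>q\<close> uses \<open>max L \<mu>\<close> so that \<open>q * w i \<le> 1\<close>, which the exponential lower bound on
  the factor \<open>1 + q * w i\<close> requires.\<close>

locale growing_matched_descent = matched_descent +
  fixes \<mu> :: real
  assumes mu_pos: "0 < \<mu>" and growth: "\<mu> / 2 * D t \<le> G t"
begin

definition q :: real where "q = \<mu> / max L \<mu>"

lemma q_bounds: "0 < q" "q \<le> 1" "q \<le> \<mu> / L"
  using mu_pos L_pos by (auto simp: q_def field_simps)

lemma q_w_bounds:
  assumes "i \<ge> 1"
  shows "0 \<le> q * w i" "q * w i \<le> 1"
  using q_bounds w_bounds[OF assms] by (auto simp: mult_le_one less_imp_le)

lemma pair_contraction:
  assumes i: "i \<ge> 1"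
  shows "exp (q * w i / 2) * D (rgt i) \<le> D (lft i)"
proof -
  have "\<mu> / 2 * D (rgt i) * w i \<le> G (rgt i) * w i"
    using growth[of "rgt i"] w_bounds(1)[OF i] by (intro mult_right_mono) auto
  also have "\<dots> \<le> L / 2 * (D (lft i) - D (rgt i))"
    by (rule weighted_pair_descent[OF i])
  finally have "\<mu> / L * (w i * D (rgt i)) \<le> D (lft i) - D (rgt i)"
    using L_pos by (simp add: field_simps)
  moreover have "q * (w i * D (rgt i)) \<le> \<mu> / L * (w i * D (rgt i))"
    using q_bounds(3) w_bounds(1)[OF i] D_nonneg[of "rgt i"] by (intro mult_right_mono) auto
  moreover have "exp (q * w i / 2) * D (rgt i) \<le> (1 + q * w i) * D (rgt i)"
    using exp_half_le_one_plus[OF q_w_bounds[OF i]] D_nonneg[of "rgt i"]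
    by (intro mult_right_mono)
  ultimately show ?thesis by (simp add: algebra_simps)
qed

lemma distance_contraction:
  "exp (q * (\<Sum>i=1..h. w i) / 2) * D (lft (Suc h)) \<le> D 0"
proof (induction h)
  case 0
  show ?case using decseqD[OF D_decseq, of 0 "lft 1"] by simp
next
  case (Suc h)
  let ?E = "exp (q * (\<Sum>i=1..h. w i) / 2)" and ?e = "exp (q * w (Suc h) / 2)"
  have "D (lft (Suc (Suc h))) \<le> D (rgt (Suc h))"
    using pairs_ordered[of "Suc h"] by (intro decseqD[OF D_decseq]) auto
  hence "?E * (?e * D (lft (Suc (Suc h)))) \<le> ?E * (?e * D (rgt (Suc h)))" by simp
  also have "\<dots> \<le> ?E * D (lft (Suc h))"
    using pair_contraction[of "Suc h"] by simp
  finally have "?E * ?e * D (lft (Suc (Suc h))) \<le> D 0" using Suc.IH unfolding mult.assoc by (rule order_trans)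
  moreover have "?E * ?e = exp (q * (\<Sum>i=1..Suc h. w i) / 2)"
    by (simp flip: exp_add add: algebra_simps add_divide_distrib)
  ultimately show ?case by simp
qed

lemma final_distance_contraction:
  assumes "rgt p \<le> N" "1 \<le> p"
  shows "D N \<le> exp (- (q * (\<Sum>i=1..p. w i) / 2)) * D 0"
proof -
  obtain h where p: "p = Suc h" using assms(2) by (cases p) auto
  let ?E = "exp (q * (\<Sum>i=1..h. w i) / 2)" and ?e = "exp (q * w (Suc h) / 2)"
  have "D N \<le> D (rgt (Suc h))"
    using assms p by (intro decseqD[OF D_decseq]) auto
  hence "?E * (?e * D N) \<le> ?E * (?e * D (rgt (Suc h)))" by simp
  also have "\<dots> \<le> ?E * D (lft (Suc h))"
    using pair_contraction[of "Suc h"] by simp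
  finally have "?E * ?e * D N \<le> D 0" using distance_contraction[of h] unfolding mult.assoc by (rule order_trans)
  moreover have "?E * ?e = exp (q * (\<Sum>i=1..p. w i) / 2)"
    by (simp flip: exp_add add: p algebra_simps add_divide_distrib)
  ultimately show ?thesis by (simp add: exp_minus field_simps)
qed

lemma initial_distance_le_gap: "q * (L / 2 * D 0) \<le> G 0"
proof -
  have "q * (L / 2 * D 0) \<le> \<mu> / L * (L / 2 * D 0)"
    using q_bounds(3) L_pos D_nonneg[of 0] by (intro mult_right_mono) auto
  also have "\<dots> \<le> G 0" using growth[of 0] L_pos by simp
  finally show ?thesis .
qed

text \<open>Contraction alone bounds the gap only by \<open>D\<close> at the last pair, with a factor that
  involves the length of that pair. Spending a final group of pairs, whose \<open>q * w i\<close> add up to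
  some \<open>c \<in> [1, 2]\<close>, on the sublinear rate avoids this: \<open>c \<ge> 1\<close> absorbs the division by the weight, and \<open>c \<le> 2\<close>
  limits the contraction that is given up to the factor \<open>exp 1\<close>.\<close>

lemma gap_contraction:
  assumes low: "\<And>i. i \<in> {1..p} \<Longrightarrow> g \<le> G (rgt i)" and "0 \<le> g"
    and large: "1 \<le> q * (\<Sum>i=1..p. w i)"
  shows "g \<le> exp (1 - q * (\<Sum>i=1..p. w i) / 2) * G 0"
proof -
  have "\<exists>h<p. 1 \<le> (\<Sum>i=Suc h..p. q * w i) \<and> (\<Sum>i=Suc h..p. q * w i) \<le> 2"
    using q_w_bounds(2) large by (intro tail_sum_between_1_and_2) (auto simp: sum_distrib_left)
  then obtain h where h: "h < p" "1 \<le> q * (\<Sum>i=Suc h..p. w i)" "q * (\<Sum>i=Suc h..p. w i) \<le> 2"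
    by (auto simp: sum_distrib_left)
  define H where "H = q * (\<Sum>i=1..h. w i) / 2"
  have split: "(\<Sum>i=1..p. w i) = (\<Sum>i=1..h. w i) + (\<Sum>i=Suc h..p. w i)"
    using h(1) sum.ub_add_nat[of 1 h w "p - h"] by simp
  have "g \<le> g * (q * (\<Sum>i=Suc h..p. w i))"
    using mult_left_mono[OF h(2) \<open>0 \<le> g\<close>] by simp
  also have "\<dots> = q * (g * (\<Sum>i=Suc h..p. w i))" by simp
  also have "\<dots> \<le> q * (L / 2 * D (lft (Suc h)))"
    using q_bounds(1) h(1) low by (intro mult_left_mono gap_times_weight) auto
  also have "\<dots> \<le> q * (L / 2 * (exp (- H) * D 0))"
    using q_bounds(1) L_pos distance_contraction[of h]
    by (intro mult_left_mono) (auto simp: H_def exp_minus field_simps)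
  also have "\<dots> = exp (- H) * (q * (L / 2 * D 0))" by simp
  also have "\<dots> \<le> exp (- H) * G 0"
    using initial_distance_le_gap by (intro mult_left_mono) auto
  also have "\<dots> \<le> exp (1 - q * (\<Sum>i=1..p. w i) / 2) * G 0"
  proof (rule mult_right_mono)
    show "exp (- H) \<le> exp (1 - q * (\<Sum>i=1..p. w i) / 2)"
      using h(3) unfolding H_def split distrib_left exp_le_cancel_iff add_divide_distrib by linarith
    have "0 \<le> \<mu> / 2 * D 0" using mu_pos D_nonneg[of 0] by simp
    thus "0 \<le> G 0" using growth[of 0] by linarith
  qed
  finally show ?thesis .
qed

end

section \<open>Geometry of the level-set projections\<close>

text \<open>On the boundary and at kinks \<open>f' x\<close> is a subgradient by definition; where it is a
  gradient, the difference quotients of \<open>f\<close> along a segment are bounded by convexity.\<close>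

lemma oracle_subgradient:
  fixes X :: "'a::euclidean_space set"
  assumes "first_order_oracle X f f'" "convex_on X f" "x \<in> X" "y \<in> X"
  shows "f x + f' x \<bullet> (y - x) \<le> f y"
proof (cases "x \<in> interior X \<and> f differentiable (at x)")
  case False
  with assms show ?thesis unfolding first_order_oracle_def by metis
next
  case True
  with assms(1,3) have "(f has_derivative (\<lambda>v. v \<bullet> f' x)) (at x)"
    unfolding first_order_oracle_def gderiv_def by metis
  hence "((f \<circ> (\<lambda>t. x + t *\<^sub>R (y - x))) has_derivative
          ((\<lambda>v. v \<bullet> f' x) \<circ> (\<lambda>t. t *\<^sub>R (y - x)))) (at (0::real))"
    by (intro diff_chain_at) (auto intro!: derivative_eq_intros)
  hence "((\<lambda>t. f (x + t *\<^sub>R (y - x))) has_real_derivative (f' x \<bullet> (y - x))) (at 0)"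
    by (simp add: has_field_derivative_def o_def inner_commute mult_commute_abs)
  hence "((\<lambda>t. (f (x + t *\<^sub>R (y - x)) - f x) / t) \<longlongrightarrow> f' x \<bullet> (y - x)) (at_right 0)"
    by (auto simp: has_field_derivative_iff intro: filterlim_mono[OF _ order_refl at_le])
  moreover have "\<forall>\<^sub>F t in at_right 0. (f (x + t *\<^sub>R (y - x)) - f x) / t \<le> f y - f x"
    using eventually_at_right_less[of 0] eventually_at_right_real[OF zero_less_one]
  proof eventually_elim
    case (elim t)
    have "f ((1 - t) *\<^sub>R x + t *\<^sub>R y) \<le> (1 - t) * f x + t * f y"
      using elim assms by (intro convex_onD) auto
    moreover have "(1 - t) *\<^sub>R x + t *\<^sub>R y = x + t *\<^sub>R (y - x)" by (simp add: algebra_simps)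
    ultimately show ?case using elim by (simp add: field_simps)
  qed
  ultimately have "f' x \<bullet> (y - x) \<le> f y - f x"
    by (intro tendsto_upperbound) auto
  thus ?thesis by simp
qed

lemma minimizer_value:
  assumes "y \<in> minimizers X f"
  shows "f y = opt_val X f"
  unfolding opt_val_def using assms
  by (intro cInf_eq_minimum[symmetric]) (auto simp: minimizers_def)

lemma opt_val_le:
  assumes "minimizers X f \<noteq> {}" "z \<in> X"
  shows "opt_val X f \<le> f z"
proof -
  obtain y where "y \<in> minimizers X f" using assms(1) by blast
  with assms(2) show ?thesis
    using minimizer_value[of y X f] by (simp add: minimizers_def)
qed

lemma closed_minimizers:
  assumes "closed X" "continuous_on X f" "minimizers X f \<noteq> {}"
  shows "closed (minimizers X f)"
proof -
  have "minimizers X f = {z \<in> X. f z \<le> opt_val X f}"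
  proof (intro equalityI subsetI)
    fix z assume "z \<in> minimizers X f"
    thus "z \<in> {z \<in> X. f z \<le> opt_val X f}"
      using minimizer_value[of z X f] by (simp add: minimizers_def)
  next
    fix z assume "z \<in> {z \<in> X. f z \<le> opt_val X f}"
    thus "z \<in> minimizers X f"
      using opt_val_le[OF assms(3)] order_trans unfolding minimizers_def by blast
  qed
  thus ?thesis using assms by (simp add: continuous_on_closed_Collect_le)
qed

lemma level_set_eq_INT:
  "level_set m fs X f f' x t =
     X \<inter> (\<Inter>i\<in>{i. i < m \<and> i \<le> t}.
        {z. f' (x (t - i)) \<bullet> z \<le> fs - f (x (t - i)) + f' (x (t - i)) \<bullet> x (t - i)})"
  by (auto simp: level_set_def algebra_simps)

lemma projection_three_point:
  fixes S :: "'a::euclidean_space set"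
  assumes "convex S" "closed S" "p \<in> S" "y \<in> S" "\<And>z. z \<in> S \<Longrightarrow> norm (p - a) \<le> norm (z - a)"
  shows "(norm (p - y))\<^sup>2 + (norm (p - a))\<^sup>2 \<le> (norm (a - y))\<^sup>2"
proof -
  have "(a - p) \<bullet> (y - p) \<le> 0"
    using assms by (intro any_closest_point_dot) (auto simp: dist_norm norm_minus_commute)
  thus ?thesis
    by (simp add: power2_norm_eq_inner inner_commute algebra_simps)
qed

text \<open>Cauchy-Schwarz turns the sum of the squared steps, which telescopes, into the squared total
  displacement; the number of steps is the price.\<close>

lemma displacement_le_distance_decrease:
  fixes x :: "nat \<Rightarrow> 'a::real_inner"
  assumes step: "\<And>t. (norm (x (Suc t) - y))\<^sup>2 + (norm (x (Suc t) - x t))\<^sup>2 \<le> (norm (x t - y))\<^sup>2"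
    and "l \<le> r"
  shows "(norm (x r - x l))\<^sup>2
           \<le> (real r - real l) * ((norm (x l - y))\<^sup>2 - (norm (x r - y))\<^sup>2)"
proof -
  have "norm (x r - x l) \<le> (\<Sum>t=l..<r. norm (x (Suc t) - x t))"
    using sum_Suc_diff'[OF \<open>l \<le> r\<close>, of x] norm_sum[of "\<lambda>t. x (Suc t) - x t" "{l..<r}"] by simp
  hence "(norm (x r - x l))\<^sup>2 \<le> (\<Sum>t=l..<r. norm (x (Suc t) - x t))\<^sup>2"
    by (intro power_mono) auto
  also have "\<dots> \<le> (\<Sum>t=l..<r. (norm (x (Suc t) - x t))\<^sup>2) * (real r - real l)"
    using sum_squared_le_sum_of_squares[of "\<lambda>t. norm (x (Suc t) - x t)" "{l..<r}"] \<open>l \<le> r\<close>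
    by simp
  also have "\<dots> \<le> (\<Sum>t=l..<r. (norm (x t - y))\<^sup>2 - (norm (x (Suc t) - y))\<^sup>2) * (real r - real l)"
    using \<open>l \<le> r\<close> step by (intro mult_right_mono sum_mono) (auto simp: le_diff_eq add.commute)
  also have "(\<Sum>t=l..<r. (norm (x t - y))\<^sup>2 - (norm (x (Suc t) - y))\<^sup>2)
      = (norm (x l - y))\<^sup>2 - (norm (x r - y))\<^sup>2"
    using sum_Suc_diff'[OF \<open>l \<le> r\<close>, of "\<lambda>t. - (norm (x t - y))\<^sup>2"] by simp
  finally show ?thesis by (simp add: mult.commute)
qed

section \<open>The bundle-level method\<close>

locale bundle_level_run =
  fixes X :: "'a::euclidean_space set" and f :: "'a \<Rightarrow> real" and f' :: "'a \<Rightarrow> 'a"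
    and x0 :: 'a and x :: "nat \<Rightarrow> 'a" and m :: nat
  assumes closed_X: "closed X" and convex_X: "convex X"
    and continuous_f: "continuous_on X f" and convex_f: "convex_on X f"
    and minimizers_nonempty: "minimizers X f \<noteq> {}"
    and f'_oracle: "first_order_oracle X f f'"
    and x0_in: "x0 \<in> X"
    and run: "bundle_level m (opt_val X f) x0 X f f' x"
begin

lemma next_in_level_set: "x (Suc t) \<in> level_set m (opt_val X f) X f f' x t"
  and next_closest: "z \<in> level_set m (opt_val X f) X f f' x t \<Longrightarrow>
    norm (x (Suc t) - x t) \<le> norm (z - x t)"
  using run by (auto simp: bundle_level_def is_arg_min_linorder)

lemma x_0: "x 0 = x0"
  using run by (simp add: bundle_level_def)

lemma iterate_in: "x t \<in> X"
  using x0_in x_0 next_in_level_set by (cases t) (auto simp: level_set_def)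

lemma minimizer_in_level_set:
  assumes "y \<in> minimizers X f"
  shows "y \<in> level_set m (opt_val X f) X f f' x t"
proof -
  have "y \<in> X" using assms by (simp add: minimizers_def)
  thus ?thesis
    using oracle_subgradient[OF f'_oracle convex_f iterate_in, of y] minimizer_value[OF assms]
    by (simp add: level_set_def)
qed

lemma step_toward_minimizer:
  assumes "y \<in> minimizers X f"
  shows "(norm (x (Suc t) - y))\<^sup>2 + (norm (x (Suc t) - x t))\<^sup>2 \<le> (norm (x t - y))\<^sup>2"
proof (rule projection_three_point)
  let ?S = "level_set m (opt_val X f) X f f' x t"
  show "convex ?S" unfolding level_set_eq_INT
    by (intro convex_Int convex_X convex_INT convex_halfspace_le)
  show "closed ?S" unfolding level_set_eq_INT
    by (intro closed_Int closed_X closed_INT ballI closed_halfspace_le)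
qed (use minimizer_in_level_set[OF assms] next_in_level_set next_closest in auto)

lemma nearest_minimizer:
  obtains y where "y \<in> minimizers X f" "infdist z (minimizers X f) = norm (z - y)"
  using infdist_attains_inf[OF closed_minimizers[OF closed_X continuous_f minimizers_nonempty]
      minimizers_nonempty, of z]
  by (auto simp: dist_norm)

lemma squared_infdist_le:
  assumes "y \<in> minimizers X f"
  shows "(infdist z (minimizers X f))\<^sup>2 \<le> (norm (z - y))\<^sup>2"
  using infdist_le[OF assms, of z] by (intro power_mono) (auto simp: dist_norm infdist_nonneg)

lemma squared_distance_decseq: "decseq (\<lambda>t. (infdist (x t) (minimizers X f))\<^sup>2)"
proof (rule decseq_SucI)
  fix t
  obtain y where y: "y \<in> minimizers X f" "infdist (x t) (minimizers X f) = norm (x t - y)"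
    by (rule nearest_minimizer)
  have "(norm (x (Suc t) - y))\<^sup>2 \<le> (norm (x t - y))\<^sup>2"
    using step_toward_minimizer[OF y(1), of t] zero_le_power2[of "norm (x (Suc t) - x t)"]
    by linarith
  thus "(infdist (x (Suc t)) (minimizers X f))\<^sup>2 \<le> (infdist (x t) (minimizers X f))\<^sup>2"
    unfolding y(2) by (rule order_trans[OF squared_infdist_le[OF y(1)]])
qed

text \<open>At \<open>x r\<close> the linearization at \<open>x l\<close> is at most the optimal value, since its cut is still
  active; smoothness on the common piece bounds the distance of \<open>f\<close> from the linearization.\<close>

lemma gap_le_displacement:
  assumes "piecewise_smooth k L X f f' Xp" "k \<le> m" "matching_pair k k Xp x l r"
  shows "f (x r) - opt_val X f \<le> L / 2 * (norm (x r - x l))\<^sup>2"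
proof -
  from assms(3) obtain j i where j: "j \<in> {1..k}" "r = l + j"
    and i: "i \<in> {1..k}" "x l \<in> Xp i" "x r \<in> Xp i"
    by (auto simp: matching_pair_def)
  have "x (Suc (r - 1)) \<in> level_set m (opt_val X f) X f f' x (r - 1)"
    by (rule next_in_level_set)
  hence "\<forall>a<m. a \<le> r - 1 \<longrightarrow>
      f (x (r - 1 - a)) + f' (x (r - 1 - a)) \<bullet> (x r - x (r - 1 - a)) \<le> opt_val X f"
    using j by (simp add: level_set_def)
  \<comment> \<open>The cut at \<open>x l\<close> has age \<open>j - 1 < m\<close> when \<open>x r\<close> is chosen from the level set at \<open>r - 1\<close>.\<close>
  from this[rule_format, of "j - 1"]
  have "f (x l) + f' (x l) \<bullet> (x r - x l) \<le> opt_val X f"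
    using j assms(2) by auto
  moreover have "f (x r) - f (x l) - f' (x l) \<bullet> (x r - x l) \<le> L / 2 * (norm (x r - x l))\<^sup>2"
    using assms(1) i iterate_in unfolding piecewise_smooth_def by blast
  ultimately show ?thesis by linarith
qed

lemma bundle_level_matched_descent:
  assumes smooth: "piecewise_smooth k L X f f' Xp" and "k \<le> m"
    and pairs: "matching_pair_seq k k Xp x lft rgt"
  shows "matched_descent (\<lambda>t. (infdist (x t) (minimizers X f))\<^sup>2)
    (\<lambda>t. f (x t) - opt_val X f) lft rgt L"
proof
  show L: "0 < L" using smooth by (simp add: piecewise_smooth_def)
  fix i :: nat assume i: "i \<ge> 1"
  have mp: "matching_pair k k Xp x (lft i) (rgt i)"
    using pairs i by (simp add: matching_pair_seq_def)
  show less: "lft i < rgt i"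
    using mp by (auto simp: matching_pair_def)
  show "rgt i \<le> lft (Suc i)" using pairs i by (simp add: matching_pair_seq_def)
  obtain y where y: "y \<in> minimizers X f"
    "infdist (x (lft i)) (minimizers X f) = norm (x (lft i) - y)"
    by (rule nearest_minimizer)
  let ?j = "real (rgt i) - real (lft i)"
  have "f (x (rgt i)) - opt_val X f \<le> L / 2 * (norm (x (rgt i) - x (lft i)))\<^sup>2"
    by (rule gap_le_displacement[OF smooth \<open>k \<le> m\<close> mp])
  also have "\<dots> \<le> L / 2 * (?j * ((norm (x (lft i) - y))\<^sup>2 - (norm (x (rgt i) - y))\<^sup>2))"
    using L less
    by (intro mult_left_mono displacement_le_distance_decrease step_toward_minimizer[OF y(1)]) auto
  also have "\<dots> \<le> L / 2 * (?j * ((infdist (x (lft i)) (minimizers X f))\<^sup>2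
      - (infdist (x (rgt i)) (minimizers X f))\<^sup>2))"
    using L less squared_infdist_le[OF y(1), of "x (rgt i)"] y(2)
    by (intro mult_left_mono) auto
  finally show "f (x (rgt i)) - opt_val X f \<le> L / 2 * ?j *
      ((infdist (x (lft i)) (minimizers X f))\<^sup>2 - (infdist (x (rgt i)) (minimizers X f))\<^sup>2)"
    by (simp add: mult.assoc)
qed (use squared_distance_decseq in auto)

end

lemma num_pairs_completed:
  assumes pairs: "matching_pair_seq k k Xp x lft rgt" and "rgt 1 \<le> N"
  shows "1 \<le> num_pairs rgt N"
    and "i \<in> {1..num_pairs rgt N} \<Longrightarrow> rgt i \<in> {1..N}"
proof -
  let ?A = "{i. 1 \<le> i \<and> rgt i \<le> N}"
  have less_Suc: "rgt i < rgt (Suc i)" if "i \<ge> 1" for i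
    using pairs that unfolding matching_pair_seq_def by (metis Suc_eq_plus1 order.strict_trans1)
  have pos: "1 \<le> rgt i" if "i \<ge> 1" for i
    using pairs that by (fastforce simp: matching_pair_seq_def matching_pair_def)
  have ge: "i \<le> rgt i" if "i \<ge> 1" for i
    using that by (induction i rule: nat_induct_at_least) (use pos less_Suc in fastforce)+
  have mono: "rgt i \<le> rgt j" if "1 \<le> i" "i \<le> j" for i j
    using that(2,1)
  proof (induction j rule: dec_induct)
    case (step j)
    thus ?case using less_Suc[of j] by simp
  qed simp
  have "?A \<subseteq> {..N}" using ge by fastforce
  hence fin: "finite ?A" by (rule finite_subset) simp
  have "1 \<in> ?A" using assms(2) by simp
  thus one: "1 \<le> num_pairs rgt N" unfolding num_pairs_def using fin by (intro Max_ge) auto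
  have "num_pairs rgt N \<in> ?A" unfolding num_pairs_def using fin \<open>1 \<in> ?A\<close> by (intro Max_in) auto
  thus "i \<in> {1..num_pairs rgt N} \<Longrightarrow> rgt i \<in> {1..N}"
    using mono[of i "num_pairs rgt N"] pos[of i] by auto
qed

text \<open>With \<open>\<kappa> = 4 * N / s\<close> this compares the rate of the theorem with the exponential rates.\<close>

lemma exp_le_powi_rate:
  fixes s :: real
  assumes "0 < s" "1 \<le> N"
  shows "exp (- s / 4) \<le> (1 + 1 / (4 * real N / s)) powi (- int N)"
proof -
  let ?b = "1 + 1 / (4 * real N / s)"
  have b: "0 < ?b" using assms by (simp add: add_pos_nonneg)
  have "?b ^ N \<le> exp (s / (4 * real N)) ^ N"
    using assms b by (intro power_mono) (auto simp: mult.commute)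
  also have "\<dots> = exp (s / 4)" using assms by (simp flip: exp_of_nat_mult)
  finally show ?thesis
    using b by (simp add: power_int_minus exp_minus le_imp_inverse_le)
qed

theorem theorem2p1:
  fixes X :: "(real ^ 'n) set" and f :: "real ^ 'n \<Rightarrow> real"
    and f' :: "real ^ 'n \<Rightarrow> real ^ 'n" and Xp :: "nat \<Rightarrow> (real ^ 'n) set"
    and x :: "nat \<Rightarrow> real ^ 'n" and x0 :: "real ^ 'n"
    and k m N :: nat and L :: real and lft rgt :: "nat \<Rightarrow> nat"
  assumes "closed X" and "convex X"
    and "\<exists>K. K-lipschitz_on X f" and "bdd_below (f ` X)"
    and "minimizers X f \<noteq> {}"
    and "convex_on X f"
    and "piecewise_smooth k L X f f' Xp"
    and "m \<ge> k" and "m \<ge> 1" and "x0 \<in> X"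
    and "bundle_level m (opt_val X f) x0 X f f' x"
    and "matching_pair_seq k k Xp x lft rgt"
    and "N \<ge> 1" and "rgt 1 \<le> N"
  shows "(MIN t\<in>{1..N}. f (x t)) - opt_val X f
           \<le> L * avg_length lft rgt N * avg_interarrival rgt N / (2 * real N)
              * (infdist x0 (minimizers X f))\<^sup>2
       \<and> (\<forall>\<mu>>0. quadratic_growth X f \<mu> \<longrightarrow>
            (let \<kappa> = effective_cond L \<mu> lft rgt N; C = 3 in
               (infdist (x N) (minimizers X f))\<^sup>2
                 \<le> (1 + 1 / \<kappa>) powi (- int N) * C * (infdist x0 (minimizers X f))\<^sup>2
             \<and> (MIN t\<in>{0..N}. f (x t)) - opt_val X f
                 \<le> (1 + 1 / \<kappa>) powi (- int N) * C * (f x0 - opt_val X f)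
             \<and> (MIN t\<in>{1..N}. f (x t)) - opt_val X f
                 \<le> (1 + 1 / \<kappa>) powi (- int N) * (C * max 1 (\<kappa> / real N)) * (f x0 - opt_val X f)))"
proof -
  let ?M = "minimizers X f" and ?fs = "opt_val X f" and ?p = "num_pairs rgt N"
  obtain K where "K-lipschitz_on X f" using assms(3) by blast
  hence cont: "continuous_on X f" by (rule lipschitz_on_continuous_on)
  have f'_oracle: "first_order_oracle X f f'" using assms(7) by (simp add: piecewise_smooth_def)
  interpret bundle_level_run X f f' x0 x m
    using assms cont f'_oracle by unfold_locales
  define D where "D = (\<lambda>t. (infdist (x t) ?M)\<^sup>2)"
  define G where "G = (\<lambda>t. f (x t) - ?fs)"
  have md: "matched_descent D G lft rgt L"
    unfolding D_def G_def by (rule bundle_level_matched_descent[OF assms(7,8,12)])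
  then interpret matched_descent D G lft rgt L .
  define S where "S = (\<Sum>i=1..?p. w i)"
  define g where "g = (MIN t\<in>{1..N}. f (x t)) - ?fs"
  note p1 = num_pairs_completed(1)[OF assms(12,14)]
  note rgt_in = num_pairs_completed(2)[OF assms(12,14)]
  have S_pos: "0 < S" unfolding S_def by (rule total_weight_pos[OF p1])
  have stats: "avg_length lft rgt N * avg_interarrival rgt N = real N / S"
    using p1 by (simp add: avg_length_def avg_interarrival_def S_def w_def)
  have g_low: "g \<le> G t" if "t \<in> {1..N}" for t
    unfolding g_def G_def using that by simp
  have g_low_pair: "g \<le> G (rgt i)" if "i \<in> {1..?p}" for i
    using rgt_in[OF that] by (rule g_low)
  have "?fs \<le> (MIN t\<in>{1..N}. f (x t))"
    using assms(13) opt_val_le[OF assms(5) iterate_in] by (subst Min_ge_iff) auto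
  hence g_nonneg: "0 \<le> g" by (simp add: g_def)
  have G0: "0 \<le> G 0" using opt_val_le[OF assms(5) iterate_in] by (simp add: G_def)
  have D0: "D 0 = (infdist x0 ?M)\<^sup>2" and G0_eq: "G 0 = f x0 - ?fs"
    by (simp_all add: D_def G_def x_0)
  have sub: "g * S \<le> L / 2 * D 0"
    unfolding S_def by (rule sublinear_gap[OF p1 g_low_pair])
  have a: "g \<le> L * avg_length lft rgt N * avg_interarrival rgt N / (2 * real N) * D 0"
  proof -
    have "g \<le> L / (2 * S) * D 0" using sub S_pos by (simp add: field_simps)
    also have "L / (2 * S) = L * (real N / S) / (2 * real N)" using assms(13) by simp
    also have "\<dots> = L * avg_length lft rgt N * avg_interarrival rgt N / (2 * real N)"
      by (simp only: stats[symmetric] mult.assoc)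
    finally show ?thesis .
  qed
  have b: "D N \<le> (1 + 1 / \<kappa>) powi (- int N) * 3 * D 0
      \<and> (MIN t\<in>{0..N}. f (x t)) - ?fs \<le> (1 + 1 / \<kappa>) powi (- int N) * 3 * G 0
      \<and> g \<le> (1 + 1 / \<kappa>) powi (- int N) * (3 * max 1 (\<kappa> / real N)) * G 0"
    if "\<mu> > 0" and qg: "quadratic_growth X f \<mu>" and \<kappa>: "\<kappa> = effective_cond L \<mu> lft rgt N"
    for \<mu> \<kappa> :: real
  proof -
    interpret growing_matched_descent D G lft rgt L \<mu>
      using that(1) qg iterate_in
      by unfold_locales (auto simp: quadratic_growth_def D_def G_def)
    define s where "s = q * S"
    have s_pos: "0 < s" using q_bounds(1) S_pos by (simp add: s_def)
    have \<kappa>_eq: "\<kappa> = 4 * real N / s"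
      unfolding \<kappa> effective_cond_def stats s_def q_def by (simp add: field_simps)
    define \<rho> where "\<rho> = (1 + 1 / \<kappa>) powi (- int N)"
    have rate: "exp (- s / 4) \<le> \<rho>"
      unfolding \<rho>_def \<kappa>_eq by (rule exp_le_powi_rate[OF s_pos assms(13)])
    have e3: "exp (1 - s / 2) \<le> \<rho> * 3"
    proof -
      have "exp (1 - s / 2) = exp (- s / 2) * exp 1" by (simp flip: exp_add)
      also have "\<dots> \<le> exp (- s / 4) * 3"
        using s_pos exp_le by (intro mult_mono) auto
      finally show ?thesis using rate by linarith
    qed
    have dist: "D N \<le> \<rho> * 3 * D 0"
    proof -
      have "D N \<le> exp (- (s / 2)) * D 0"
        unfolding s_def S_def using rgt_in[of ?p] p1 by (intro final_distance_contraction) auto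
      also have "\<dots> \<le> exp (1 - s / 2) * D 0" using D_nonneg[of 0] by (intro mult_right_mono) auto
      also have "\<dots> \<le> \<rho> * 3 * D 0" using e3 D_nonneg[of 0] by (rule mult_right_mono)
      finally show ?thesis .
    qed
    have min0: "(MIN t\<in>{0..N}. f (x t)) - ?fs \<le> g"
      unfolding g_def using assms(13) by (simp add: Min_antimono image_mono)
    have min0': "(MIN t\<in>{0..N}. f (x t)) - ?fs \<le> G 0" by (simp add: G_def)
    show ?thesis
    proof (cases "1 \<le> s")
      case True
      have g3: "g \<le> \<rho> * 3 * G 0"
      proof -
        have "g \<le> exp (1 - s / 2) * G 0"
          using gap_contraction[OF g_low_pair g_nonneg] True by (simp add: s_def S_def)
        also have "\<dots> \<le> \<rho> * 3 * G 0" using e3 G0 by (rule mult_right_mono)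
        finally show ?thesis .
      qed
      have "0 \<le> \<rho>" using rate exp_ge_zero order_trans by blast
      hence "\<rho> * 3 * G 0 \<le> \<rho> * (3 * max 1 (\<kappa> / real N)) * G 0"
        using G0 by (intro mult_right_mono mult_left_mono) auto
      thus ?thesis using dist min0 g3 unfolding \<rho>_def[symmetric] by linarith
    next
      \<comment> \<open>Here the rate is at least \<open>1 / 3\<close>, so \<open>x0\<close> itself satisfies the bound over \<open>{0..N}\<close>;
        the bound over \<open>{1..N}\<close> is the sublinear rate, since \<open>\<kappa> / N = 4 / s\<close>.\<close>
      case False
      have "1 \<le> exp (1 - s / 2)" using False by simp
      hence \<rho>3: "1 \<le> \<rho> * 3" using e3 by linarith
      have "s * g \<le> G 0"
      proof -
        have "s * g \<le> q * (L / 2 * D 0)"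
          using mult_left_mono[OF sub, of q] q_bounds(1) by (simp add: s_def mult.commute mult.left_commute)
        thus ?thesis using initial_distance_le_gap by linarith
      qed
      hence "g \<le> 1 / s * G 0" using s_pos by (simp add: field_simps)
      also have "\<dots> \<le> \<rho> * (3 * max 1 (\<kappa> / real N)) * G 0"
      proof (rule mult_right_mono[OF _ G0])
        have "1 / s \<le> \<kappa> / real N"
          using s_pos assms(13) by (simp add: \<kappa>_eq field_simps)
        also have "\<dots> \<le> max 1 (\<kappa> / real N)" by simp
        also have "\<dots> \<le> \<rho> * 3 * max 1 (\<kappa> / real N)"
          using mult_right_mono[OF \<rho>3, of "max 1 (\<kappa> / real N)"] by simp
        finally show "1 / s \<le> \<rho> * (3 * max 1 (\<kappa> / real N))" by (simp add: mult.assoc)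
      qed
      finally have "g \<le> \<rho> * (3 * max 1 (\<kappa> / real N)) * G 0" .
      moreover have "G 0 \<le> \<rho> * 3 * G 0" using mult_right_mono[OF \<rho>3 G0] by simp
      ultimately show ?thesis using dist min0' unfolding \<rho>_def[symmetric] by linarith
    qed
  qed
  show ?thesis
    unfolding Let_def D0[symmetric] G0_eq[symmetric] g_def[symmetric]
    using a b unfolding D_def by blast
qed

end
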